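(* Let $s>0$, $a>0$, $\alpha_{12}\ge0$, and let $(\gamma_k)_{k\ge1}$ be the sequence of perturbation bounds defined in the context, evaluated with each of the perturbation sizes $\beta,\beta_1,\beta_2$ replaced by $a$. Then for every $k\ge2$, $$\gamma_k\approx h(s^k,a^k)+\mathbf 1\{\alpha_{12}>0\}\,\alpha_{12}^{k-1}\,h(s^{2k-1},a^k).$$ That is, $\gamma_k$ is a polynomial in $s,a,\alpha_{12}$ such that: the part free of $\alpha_{12}$ is a polynomial in $(s,a)$ with leading powers $s^k$ and $a^k$; the highest power of $\alpha_{12}$ occurring is $\alpha_{12}^{k-1}$, and its coefficient is a polynomial in $(s,a)$ with leading powers $s^{2k-1}$ and $a^k$ (terms with intermediate powers $\alpha_{12}^j$, $0<j<k-1$, are omitted from the display). In particular $$\gamma_2\approx h(s^2,a^2)+\mathbf 1\{\alpha_{12}>0\}\alpha_{12}h(s^3,a^2),\quad \gamma_3\approx h(s^3,a^3)+\mathbf 1\{\alpha_{12}>0\}\alpha_{12}^2s^2h(s^3,a^3),\quad \gamma_4\approx h(s^4,a^4)+\mathbf 1\{\alpha_{12}>0\}\alpha_{12}^3h(s^7,a^4).$$ For eigenspaces, i.e. $\alpha_{12}=0$, the bound $\gamma_k$ is a homogeneous polynomial in the product $as$.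
   Context: Setting: $M\in\mathbb R^{p\times p}$, $L^{\mathsf T}MR=R^{-1}MR=\begin{bmatrix}\Lambda_I&\Lambda_{IJ}\\0&\Lambda_J\end{bmatrix}$ with $R=[R_I\ R_J]$ nonsingular, $L=[L_I\ L_J]=R^{-\mathsf T}$, $\Lambda_I\in\mathbb R^{q\times q}$, and the spectra of $\Lambda_I$ and $\Lambda_J$ disjoint. For an estimator $\hat M$ of $M$, the perturbation size is $a=\max\{\|\hat M-M\|_F,\ \|L_j^{\mathsf T}(M-\hat M)R_i\|\ (i,j\in\{I,J\})\}$; the reciprocal eigenvalue separation is $s=\|\{(\Lambda_I^{\mathsf T}\otimes I_{p-q})-(I_q\otimes\Lambda_J)\}^{-1}\|_F$; and $\alpha_{12}=\|\Lambda_{IJ}\|_F$ is the norm of the upper-right block of $L^{\mathsf T}MR$. Here $\beta,\beta_1,\beta_2\ge0$ are norm bounds on the blocks of $L^{\mathsf T}(\hat M-M)R$ ($\beta$: the two diagonal blocks; $\beta_1$: the upper-right block; $\beta_2$: the lower-left block). The numbers $\gamma_k$ are the coefficients of the power-series bound $\sum_k\gamma_k|t|^k$ for the change of the invariant subspace $\operatorname{span}R_I$ when $M$ is perturbed along a parameter $t$, given by $$\gamma_1=s\beta_2,\qquad\gamma_2=s(\beta\gamma_1+\alpha_{12}\gamma_1^2),\qquad \gamma_m=(s\beta)^{m-2}\gamma_2+\sum_{k=0}^{m-3}\iota_{m,k}\quad(m\ge3),$$ $$\iota_{m,k}=s^{k+1}\beta^k\beta_1\sum_{j=1}^{m-2-k}\gamma_{m-(k+1)-j}\gamma_j+s^{k+1}\beta^k\alpha_{12}\sum_{j=1}^{m-1-k}\gamma_{m-j-k}\gamma_j.$$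 $h(s^x,a^y)$ denotes a generic polynomial in $s$ and $a$ with leading powers $x$ in $s$ and $y$ in $a$ (different occurrences may be different polynomials). *)

theory Defs
  imports "HOL-Computational_Algebra.Polynomial"
begin

(* Coefficients gamma_m, m >= 1, of the power-series bound; the value at index 0 is a dummy.
   \<alpha> is the norm of the upper-right block \<Lambda>_IJ. The recursion inlines iota_(m,k); lemmas
   gamma_1, gamma_2 and gamma_rec restore the usual presentation. *)
fun gamma :: "real \<Rightarrow> real \<Rightarrow> real \<Rightarrow> real \<Rightarrow> real \<Rightarrow> nat \<Rightarrow> real" where
  "gamma s \<alpha> \<beta> \<beta>1 \<beta>2 m =
    (if m = 0 then 0
     else if m = 1 then s * \<beta>2
     else if m = 2 then s * (\<beta> * gamma s \<alpha> \<beta> \<beta>1 \<beta>2 1 + \<alpha> * (gamma s \<alpha> \<beta> \<beta>1 \<beta>2 1)^2)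
     else (s * \<beta>)^(m - 2) * gamma s \<alpha> \<beta> \<beta>1 \<beta>2 2
       + (\<Sum>k\<in>{0..m - 3}.
            s^(k+1) * \<beta>^k * \<beta>1 *
              (\<Sum>j\<in>{1..m - 2 - k}. gamma s \<alpha> \<beta> \<beta>1 \<beta>2 (m - (k+1) - j) * gamma s \<alpha> \<beta> \<beta>1 \<beta>2 j)
          + s^(k+1) * \<beta>^k * \<alpha> *
              (\<Sum>j\<in>{1..m - 1 - k}. gamma s \<alpha> \<beta> \<beta>1 \<beta>2 (m - j - k) * gamma s \<alpha> \<beta> \<beta>1 \<beta>2 j)))"

declare gamma.simps [simp del]

definition iota :: "real \<Rightarrow> real \<Rightarrow> real \<Rightarrow> real \<Rightarrow> real \<Rightarrow> nat \<Rightarrow> nat \<Rightarrow> real" where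
  "iota s \<alpha> \<beta> \<beta>1 \<beta>2 m k =
     s^(k+1) * \<beta>^k * \<beta>1 *
       (\<Sum>j\<in>{1..m - 2 - k}. gamma s \<alpha> \<beta> \<beta>1 \<beta>2 (m - (k+1) - j) * gamma s \<alpha> \<beta> \<beta>1 \<beta>2 j)
   + s^(k+1) * \<beta>^k * \<alpha> *
       (\<Sum>j\<in>{1..m - 1 - k}. gamma s \<alpha> \<beta> \<beta>1 \<beta>2 (m - j - k) * gamma s \<alpha> \<beta> \<beta>1 \<beta>2 j)"

lemma gamma_1: "gamma s \<alpha> \<beta> \<beta>1 \<beta>2 1 = s * \<beta>2"
  by (subst gamma.simps) simp

lemma gamma_2:
  "gamma s \<alpha> \<beta> \<beta>1 \<beta>2 2 =
     s * (\<beta> * gamma s \<alpha> \<beta> \<beta>1 \<beta>2 1 + \<alpha> * (gamma s \<alpha> \<beta> \<beta>1 \<beta>2 1)^2)"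
  by (subst gamma.simps) simp

lemma gamma_rec:
  assumes "m \<ge> 3"
  shows "gamma s \<alpha> \<beta> \<beta>1 \<beta>2 m =
    (s * \<beta>)^(m - 2) * gamma s \<alpha> \<beta> \<beta>1 \<beta>2 2 + (\<Sum>k\<in>{0..m - 3}. iota s \<alpha> \<beta> \<beta>1 \<beta>2 m k)"
  using assms unfolding iota_def by (subst gamma.simps) simp

(* A polynomial in (s, a) is a polynomial in a (outer variable) whose coefficients are
   polynomials in s (inner variable): coeff (coeff h j) i is the coefficient of s^i a^j. *)
type_synonym poly_sa = "real poly poly"

definition eval_sa :: "poly_sa \<Rightarrow> real \<Rightarrow> real \<Rightarrow> real" where
  "eval_sa h s a = poly (poly h [:a:]) s"

definition degree_a :: "poly_sa \<Rightarrow> nat" where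
  "degree_a h = degree h"

definition degree_s :: "poly_sa \<Rightarrow> nat" where
  "degree_s h = (MAX j\<in>{..degree h}. degree (coeff h j))"

(* h is of the form h(s^x, a^y): the highest powers of s and of a occurring in h are s^x and
   a^y, and they occur together in the monomial s^x a^y. The last clause also rules out h = 0. *)
definition leading_powers :: "poly_sa \<Rightarrow> nat \<Rightarrow> nat \<Rightarrow> bool" where
  "leading_powers h x y \<longleftrightarrow> degree_s h = x \<and> degree_a h = y \<and> coeff (coeff h y) x \<noteq> 0"

(* f(s,a,\<alpha>) \<approx> h0(s,a) + 1{\<alpha> > 0} \<alpha>^d h1(s,a): as a polynomial in (s, a, \<alpha>), f has
   \<alpha>-free part h0 and \<alpha>^d-coefficient h1, has no higher power of \<alpha>, and only the terms with
   \<alpha>^j for 0 < j < d are left out of the display. The polynomials do not depend on s, a, \<alpha>. *)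
definition approx_form ::
  "(real \<Rightarrow> real \<Rightarrow> real \<Rightarrow> real) \<Rightarrow> poly_sa \<Rightarrow> nat \<Rightarrow> poly_sa \<Rightarrow> bool" where
  "approx_form f h0 d h1 \<longleftrightarrow>
    (\<exists>c :: nat \<Rightarrow> poly_sa. \<forall>s a \<alpha>. s > 0 \<longrightarrow> a > 0 \<longrightarrow> \<alpha> \<ge> 0 \<longrightarrow>
       f s a \<alpha> = eval_sa h0 s a + (\<Sum>j\<in>{0<..<d}. \<alpha>^j * eval_sa (c j) s a)
                 + of_bool (\<alpha> > 0) * \<alpha>^d * eval_sa h1 s a)"

definition gamma_bound :: "nat \<Rightarrow> real \<Rightarrow> real \<Rightarrow> real \<Rightarrow> real" where
  "gamma_bound k s a \<alpha> = gamma s \<alpha> a a a k"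

end

theory Submission
  imports Defs
begin

text \<open>
  With all perturbation sizes equal to \<open>a\<close>, the recursion for \<open>\<gamma>\<^sub>m\<close> is homogeneous.
  If \<open>\<gamma>\<^sub>n\<close> is divided by \<open>(a s)\<^sup>n\<close> for every \<open>n\<close>, then each summand of the recursion for \<open>\<gamma>\<^sub>m\<close> loses exactly the factor \<open>(a s)\<^sup>m\<close>: the summands
  with \<open>\<beta>\<^sub>1 = a\<close> contain no further variable, and those with \<open>\<alpha>\<close> keep one factor \<open>\<alpha> s\<close>. Hence
  \[ \gamma_m = (a s)^m \, G_m(\alpha s) \]
  for univariate polynomials \<open>G\<^sub>m\<close> with numerical coefficients (\<open>gamma_bound_eq\<close>). A factor \<open>\<alpha>\<close>
  therefore always comes together with one further factor \<open>s\<close> and none of \<open>a\<close>, so that the coefficient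
  of \<open>\<alpha>\<^sup>j\<close> in \<open>\<gamma>\<^sub>m\<close> is a single monomial, a multiple of \<open>s\<^sup>m\<^sup>+\<^sup>j a\<^sup>m\<close>.

  It remains to see that \<open>G\<^sub>m\<close> has degree exactly \<open>m - 1\<close> and a nonzero constant term. No cancellation
  can occur, since all coefficients are nonnegative, so it suffices to find one positive contribution to
  either coefficient: the constant term of \<open>G\<^sub>2 = 1 + X\<close> gives the first, and the product
  \<open>X G\<^sub>m\<^sub>-\<^sub>1 G\<^sub>1\<close> carries the top coefficient from \<open>m - 1\<close> to \<open>m\<close>.
\<close>

section \<open>The normalised polynomials\<close>

text \<open>
  This is the recursion for \<open>\<gamma>\<^sub>m\<close> after division by \<open>(a s)\<^sup>m\<close>, with \<open>X\<close> standing for \<open>\<alpha> s\<close>. The initial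
  term is \<open>G\<^sub>2 = 1 + X\<close>; for \<open>m = 2\<close> the sum is empty. The value 1 at index 0 is a default.
\<close>
fun gamma_poly :: "nat \<Rightarrow> real poly" where
  "gamma_poly m =
    (if m < 2 then 1
     else [:1, 1:] + (\<Sum>k\<in>{0..<m - 2}.
            (\<Sum>j\<in>{1..m - 2 - k}. gamma_poly (m - (k + 1) - j) * gamma_poly j)
          + [:0, 1:] * (\<Sum>j\<in>{1..m - 1 - k}. gamma_poly (m - j - k) * gamma_poly j)))"

declare gamma_poly.simps [simp del]

lemma gamma_poly_1: "gamma_poly (Suc 0) = 1"
  by (subst gamma_poly.simps) simp

lemma gamma_poly_2: "gamma_poly 2 = [:1, 1:]"
  by (subst gamma_poly.simps) simp

lemma gamma_poly_rec:
  assumes "m \<ge> 2"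
  shows "gamma_poly m = [:1, 1:] + (\<Sum>k\<in>{0..<m - 2}.
            (\<Sum>j\<in>{1..m - 2 - k}. gamma_poly (m - (k + 1) - j) * gamma_poly j)
          + [:0, 1:] * (\<Sum>j\<in>{1..m - 1 - k}. gamma_poly (m - j - k) * gamma_poly j))"
  using assms by (subst gamma_poly.simps) simp

text \<open>
  In \<open>\<gamma>\<^sub>n\<^sub>-\<^sub>j \<gamma>\<^sub>j\<close> the powers of \<open>a s\<close> multiply to \<open>(a s)\<^sup>n\<close> for every \<open>j\<close>, so a whole convolution sum scales
  by \<open>(a s)\<^sup>n\<close>. The prefactors in \<open>iota\<close> supply the missing \<open>(a s)\<^sup>m\<^sup>-\<^sup>n\<close>: with \<open>n = m - k - 1\<close> for the
  first convolution, and with \<open>n = m - k\<close> and a factor \<open>\<alpha> s\<close> left over for the second.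
\<close>
theorem gamma_bound_eq:
  assumes "m \<ge> 1"
  shows "gamma_bound m s a \<alpha> = (a * s) ^ m * poly (gamma_poly m) (\<alpha> * s)"
  using assms
proof (induction m rule: less_induct)
  case (less m)
  let ?g = "\<lambda>n. gamma s \<alpha> a a a n"
  let ?G = "\<lambda>n. poly (gamma_poly n) (\<alpha> * s)"
  have IH: "?g n = (a * s) ^ n * ?G n" if "1 \<le> n" "n < m" for n
    using less.IH[of n] that by (simp add: gamma_bound_def)
  have g2: "?g 2 = (a * s) ^ 2 * (1 + \<alpha> * s)"
    by (simp only: gamma_2 gamma_1) (simp add: power2_eq_square algebra_simps)
  consider "m = 1" | "m = 2" | "m \<ge> 3"
    using less.prems by linarith
  then show ?case
  proof cases
    case 1
    then show ?thesis
      using gamma_1[of s \<alpha> a a a] by (simp add: gamma_bound_def gamma_poly_1)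
  next
    case 2
    then show ?thesis
      using g2 by (simp add: gamma_bound_def gamma_poly_2)
  next
    case 3
    have conv: "(\<Sum>j\<in>{1..n - 1}. ?g (n - j) * ?g j)
        = (a * s) ^ n * (\<Sum>j\<in>{1..n - 1}. ?G (n - j) * ?G j)" if "n \<le> m" for n
      unfolding sum_distrib_left
    proof (rule sum.cong[OF refl])
      fix j assume "j \<in> {1..n - 1}"
      then have j: "1 \<le> j" "j < n" by auto
      have "(a * s) ^ (n - j) * (a * s) ^ j = (a * s) ^ n"
        using j by (simp flip: power_add)
      then show "?g (n - j) * ?g j = (a * s) ^ n * (?G (n - j) * ?G j)"
        using j that IH[of j] IH[of "n - j"] by (simp add: algebra_simps)
    qed
    have iota: "iota s \<alpha> a a a m k = (a * s) ^ m *
        ((\<Sum>j\<in>{1..m - 2 - k}. ?G (m - (k + 1) - j) * ?G j)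
          + \<alpha> * s * (\<Sum>j\<in>{1..m - 1 - k}. ?G (m - j - k) * ?G j))"
      if k: "k \<in> {0..<m - 2}" for k
    proof -
      have c1: "(\<Sum>j\<in>{1..m - 2 - k}. ?g (m - (k + 1) - j) * ?g j)
          = (a * s) ^ (m - (k + 1)) * (\<Sum>j\<in>{1..m - 2 - k}. ?G (m - (k + 1) - j) * ?G j)"
        using conv[of "m - (k + 1)"] by simp
      have c2: "(\<Sum>j\<in>{1..m - 1 - k}. ?g (m - j - k) * ?g j)
          = (a * s) ^ (m - k) * (\<Sum>j\<in>{1..m - 1 - k}. ?G (m - j - k) * ?G j)"
        using conv[of "m - k"] by (simp add: add.commute)
      have "s ^ (k + 1) * a ^ k * a * (a * s) ^ (m - (k + 1)) = (a * s) ^ (k + 1 + (m - (k + 1)))"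
        unfolding power_add by (simp add: power_mult_distrib)
      moreover have "k + 1 + (m - (k + 1)) = m" "k + (m - k) = m"
        using k by auto
      ultimately have p1: "s ^ (k + 1) * a ^ k * a * (a * s) ^ (m - (k + 1)) = (a * s) ^ m"
        by (simp only:)
      have "s ^ (k + 1) * a ^ k * \<alpha> * (a * s) ^ (m - k) = (a * s) ^ (k + (m - k)) * \<alpha> * s"
        unfolding power_add by (simp add: power_mult_distrib)
      then have p2: "s ^ (k + 1) * a ^ k * \<alpha> * (a * s) ^ (m - k) = (a * s) ^ m * \<alpha> * s"
        by (simp only: \<open>k + (m - k) = m\<close>)
      show ?thesis
        unfolding iota_def c1 c2 distrib_left by (simp only: mult.assoc[symmetric] p1 p2)
    qed
    have "m - 2 + 2 = m"
      using 3 by simp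
    then have pow: "(s * a) ^ (m - 2) * (a * s) ^ 2 = (a * s) ^ m"
      by (metis mult.commute power_add)
    have "{0..m - 3} = {0..<m - 2}"
      using 3 by auto
    then have "gamma_bound m s a \<alpha> = (s * a) ^ (m - 2) * ?g 2 + (\<Sum>k\<in>{0..<m - 2}. iota s \<alpha> a a a m k)"
      using gamma_rec[OF 3, of s \<alpha> a a a] by (simp add: gamma_bound_def)
    also have "\<dots> = (a * s) ^ m * (1 + \<alpha> * s) + (\<Sum>k\<in>{0..<m - 2}. iota s \<alpha> a a a m k)"
      unfolding g2 pow[symmetric] by (simp add: mult.assoc)
    also have "\<dots> = (a * s) ^ m * ?G m"
      using 3 by (simp add: iota gamma_poly_rec[of m] poly_sum sum_distrib_left distrib_left)
    finally show ?thesis .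
  qed
qed

section \<open>Degree and extreme coefficients\<close>

lemma coeff_gamma_poly_nonneg: "coeff (gamma_poly m) i \<ge> 0"
proof (induction m arbitrary: i rule: less_induct)
  case (less m)
  show ?case
  proof (cases "m < 2")
    case True
    then show ?thesis by (subst gamma_poly.simps) (simp add: coeff_1)
  next
    case False
    have prod: "coeff (gamma_poly n * gamma_poly j) i \<ge> 0" if "n < m" "j < m" for n j i
      unfolding coeff_mult using that by (intro sum_nonneg mult_nonneg_nonneg less.IH)
    have X: "coeff ([:0, 1:] * p) i \<ge> 0" if "\<And>i. coeff p i \<ge> 0" for p :: "real poly" and i
      using that by (simp add: coeff_pCons split: nat.split)
    have "coeff [:1, 1 :: real:] i \<ge> 0"
      by (simp add: coeff_pCons split: nat.split)
    then show ?thesis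
      using False
      by (subst gamma_poly_rec, simp)
         (simp only: coeff_add coeff_sum,
          intro add_nonneg_nonneg sum_nonneg X,
          auto simp: coeff_sum simp del: mult_pCons_left intro!: sum_nonneg prod)
  qed
qed

text \<open>
  By induction a product \<open>G\<^sub>n\<^sub>-\<^sub>j G\<^sub>j\<close> has degree at most \<open>n - 2\<close>. The terms without \<open>X\<close> have \<open>n < m\<close>, and
  in the others \<open>n \<le> m\<close>, so that the factor \<open>X\<close> leads to degree \<open>m - 1\<close> at most.
\<close>
lemma degree_gamma_poly_le: "degree (gamma_poly m) \<le> m - 1"
proof (induction m rule: less_induct)
  case (less m)
  show ?case
  proof (cases "m < 2")
    case True
    then show ?thesis by (subst gamma_poly.simps) simp
  next
    case False
    have prod: "degree (gamma_poly n * gamma_poly j) \<le> n + j - 2"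
      if "1 \<le> j" "j < m" "1 \<le> n" "n < m" for n j
      using degree_mult_le[of "gamma_poly n" "gamma_poly j"] less.IH[of n] less.IH[of j] that
      by linarith
    have shift: "degree ([:0, 1:] * p) \<le> Suc n" if "degree p \<le> n" for p :: "real poly" and n
      using degree_mult_le[of "[:0, 1:]" p] that by simp
    have summand: "degree ((\<Sum>j\<in>{1..m - 2 - k}. gamma_poly (m - (k + 1) - j) * gamma_poly j)
          + [:0, 1:] * (\<Sum>j\<in>{1..m - 1 - k}. gamma_poly (m - j - k) * gamma_poly j)) \<le> m - 1"
      if k: "k \<in> {0..<m - 2}" for k
    proof (rule degree_add_le)
      show "degree (\<Sum>j\<in>{1..m - 2 - k}. gamma_poly (m - (k + 1) - j) * gamma_poly j) \<le> m - 1"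
        using k by (intro degree_sum_le order.trans[OF prod]) auto
      have "degree (\<Sum>j\<in>{1..m - 1 - k}. gamma_poly (m - j - k) * gamma_poly j) \<le> m - 2"
        using k by (intro degree_sum_le order.trans[OF prod]) auto
      from shift[OF this]
      show "degree ([:0, 1:] * (\<Sum>j\<in>{1..m - 1 - k}. gamma_poly (m - j - k) * gamma_poly j)) \<le> m - 1"
        using False by simp
    qed
    show ?thesis
      using False
      by (subst gamma_poly_rec, simp, intro degree_add_le[OF _ degree_sum_le] summand) auto
  qed
qed

lemma coeff_gamma_poly_0_pos: "coeff (gamma_poly m) 0 > 0"
proof (cases "m < 2")
  case True
  then show ?thesis by (subst gamma_poly.simps) simp
next
  case False
  have "0 \<le> coeff (\<Sum>k\<in>{0..<m - 2}.
            (\<Sum>j\<in>{1..m - 2 - k}. gamma_poly (m - (k + 1) - j) * gamma_poly j)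
          + [:0, 1:] * (\<Sum>j\<in>{1..m - 1 - k}. gamma_poly (m - j - k) * gamma_poly j)) 0"
    by (auto simp: coeff_sum coeff_mult_0 intro!: sum_nonneg mult_nonneg_nonneg coeff_gamma_poly_nonneg)
  then show ?thesis
    using False by (subst gamma_poly_rec) auto
qed

lemma coeff_mult_gamma_poly_nonneg: "coeff (gamma_poly m * gamma_poly n) i \<ge> 0"
  unfolding coeff_mult by (intro sum_nonneg mult_nonneg_nonneg coeff_gamma_poly_nonneg)

lemma coeff_gamma_poly_top_pos:
  assumes "m \<ge> 1"
  shows "coeff (gamma_poly m) (m - 1) > 0"
  using assms
proof (induction m rule: nat_induct_at_least)
  case base
  then show ?case by (simp add: gamma_poly_1)
next
  case (Suc n)
  show ?case
  proof (cases "n = 1")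
    case True
    then show ?thesis using gamma_poly_2 by (simp add: numeral_2_eq_2)
  next
    case False
    then have "n \<ge> 2"
      using Suc.hyps by simp
    then obtain l where n: "n = Suc (Suc l)"
      by (auto simp: le_iff_add)
    define m where "m = Suc n"
    let ?t = "\<lambda>k. coeff ((\<Sum>j\<in>{1..m - 2 - k}. gamma_poly (m - (k + 1) - j) * gamma_poly j)
          + [:0, 1:] * (\<Sum>j\<in>{1..m - 1 - k}. gamma_poly (m - j - k) * gamma_poly j)) n"
    have t: "?t k \<ge> 0" for k
      by (auto simp: coeff_sum n intro!: add_nonneg_nonneg sum_nonneg coeff_mult_gamma_poly_nonneg)
    \<comment> \<open>The product \<open>X G\<^sub>n G\<^sub>1\<close> is the summand with \<open>k = 0\<close> and \<open>j = 1\<close>.\<close>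
    have "0 < coeff (gamma_poly n) (n - 1)"
      by (rule Suc.IH)
    also have "\<dots> = coeff (gamma_poly (m - 1) * gamma_poly 1) (n - 1)"
      by (simp add: gamma_poly_1 m_def)
    also have "\<dots> \<le> (\<Sum>j\<in>{1..m - 1}. coeff (gamma_poly (m - j) * gamma_poly j) (n - 1))"
      by (rule member_le_sum) (auto simp: m_def n coeff_mult_gamma_poly_nonneg)
    also have "\<dots> \<le> ?t 0"
      by (auto simp: coeff_sum n intro!: sum_nonneg coeff_mult_gamma_poly_nonneg)
    also have "\<dots> \<le> (\<Sum>k\<in>{0..<m - 2}. ?t k)"
      by (intro member_le_sum[where f = ?t] t) (auto simp: m_def n)
    also have "\<dots> \<le> coeff (gamma_poly m) n"
      using gamma_poly_rec[of m] by (simp add: coeff_sum m_def n)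
    finally show ?thesis
      by (simp add: m_def)
  qed
qed

section \<open>Expansion in powers of \<open>\<alpha>\<close>\<close>

lemma eval_sa_monom: "eval_sa (monom (monom c x) y) s a = c * s ^ x * a ^ y"
proof -
  have "[:a:] ^ y = [:a ^ y:]" by (induction y) auto
  then show ?thesis by (simp add: eval_sa_def poly_monom mult_ac)
qed

lemma leading_powers_monom:
  assumes "c \<noteq> 0"
  shows "leading_powers (monom (monom c x) y) x y"
proof -
  have "(MAX j\<in>{..y}. degree (coeff (monom (monom c x) y) j)) = x"
    using assms by (intro Max_eqI) (auto simp: degree_monom_eq)
  then show ?thesis
    using assms by (simp add: leading_powers_def degree_s_def degree_a_def degree_monom_eq)
qed

text \<open>
  The coefficient of \<open>\<alpha>\<^sup>j\<close> in \<open>(a s)\<^sup>k G\<^sub>k(\<alpha> s)\<close> is the monomial \<open>g\<^sub>j s\<^sup>k\<^sup>+\<^sup>j a\<^sup>k\<close>, where \<open>g\<^sub>j\<close> is the \<open>j\<close>-th coefficient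
  of \<open>G\<^sub>k\<close>; the exponent \<open>2 k - 1\<close> is \<open>k + j\<close> for \<open>j = k - 1\<close>.
\<close>
lemma approx_form_gamma_bound:
  assumes "k \<ge> 2"
  shows "approx_form (gamma_bound k)
           (monom (monom (coeff (gamma_poly k) 0) k) k) (k - 1)
           (monom (monom (coeff (gamma_poly k) (k - 1)) (2 * k - 1)) k)"
  unfolding approx_form_def
proof (intro exI allI impI)
  fix s a \<alpha> :: real
  assume "s > 0" "a > 0" "\<alpha> \<ge> 0"
  let ?c = "coeff (gamma_poly k)"
  let ?f = "\<lambda>j. \<alpha> ^ j * eval_sa (monom (monom (?c j) (k + j)) k) s a"
  have "gamma_bound k s a \<alpha> = (a * s) ^ k * poly (gamma_poly k) (\<alpha> * s)"
    using assms by (intro gamma_bound_eq) simp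
  also have "poly (gamma_poly k) (\<alpha> * s) = (\<Sum>j\<le>k - 1. ?c j * (\<alpha> * s) ^ j)"
    unfolding poly_altdef using degree_gamma_poly_le[of k]
    by (intro sum.mono_neutral_left) (auto simp: coeff_eq_0 not_le)
  also have "(a * s) ^ k * \<dots> = (\<Sum>j\<le>k - 1. ?f j)"
    by (simp add: eval_sa_monom sum_distrib_left power_add power_mult_distrib mult_ac)
  also have "{..k - 1} = insert 0 (insert (k - 1) {0<..<k - 1})"
    using assms by auto
  also have "sum ?f \<dots> = ?f 0 + (\<Sum>j\<in>{0<..<k - 1}. ?f j) + ?f (k - 1)"
    using assms by simp
  \<comment> \<open>For \<open>\<alpha> = 0\<close> both sides vanish, because the exponent \<open>k - 1\<close> is positive.\<close>
  also have "?f (k - 1) = of_bool (\<alpha> > 0) * \<alpha> ^ (k - 1) *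
      eval_sa (monom (monom (?c (k - 1)) (2 * k - 1)) k) s a"
    using assms \<open>\<alpha> \<ge> 0\<close> by (cases "\<alpha> = 0") (auto simp: mult_2)
  finally show "gamma_bound k s a \<alpha> = eval_sa (monom (monom (?c 0) k) k) s a
      + (\<Sum>j\<in>{0<..<k - 1}. ?f j)
      + of_bool (\<alpha> > 0) * \<alpha> ^ (k - 1) *
          eval_sa (monom (monom (?c (k - 1)) (2 * k - 1)) k) s a"
    by simp
qed

theorem theorem6:
  shows "(\<forall>k\<ge>2. \<exists>h0 h1. leading_powers h0 k k \<and> leading_powers h1 (2 * k - 1) k \<and>
            approx_form (gamma_bound k) h0 (k - 1) h1) \<and>
         (\<exists>h0 h1. leading_powers h0 2 2 \<and> leading_powers h1 3 2 \<and>
            approx_form (gamma_bound 2) h0 1 h1) \<and>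
         (\<exists>h0 h1. leading_powers h0 3 3 \<and> leading_powers h1 3 3 \<and>
            approx_form (gamma_bound 3) h0 2 (smult (monom 1 2) h1)) \<and>
         (\<exists>h0 h1. leading_powers h0 4 4 \<and> leading_powers h1 7 4 \<and>
            approx_form (gamma_bound 4) h0 3 h1) \<and>
         (\<forall>k\<ge>1. \<exists>c::real. c \<noteq> 0 \<and>
            (\<forall>s a. s > 0 \<longrightarrow> a > 0 \<longrightarrow> gamma_bound k s a 0 = poly (monom c k) (a * s)))"
proof (intro conjI)
  let ?c = "\<lambda>k. coeff (gamma_poly k)"
  have c: "?c k 0 \<noteq> 0" for k
    using coeff_gamma_poly_0_pos[of k] by simp
  have d: "?c k (k - 1) \<noteq> 0" if "k \<ge> 1" for k
    using coeff_gamma_poly_top_pos[OF that] by simp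
  have general: "\<exists>h0 h1. leading_powers h0 k k \<and> leading_powers h1 (2 * k - 1) k \<and>
      approx_form (gamma_bound k) h0 (k - 1) h1" if "k \<ge> 2" for k
    using leading_powers_monom[OF c] leading_powers_monom[OF d] approx_form_gamma_bound[OF that] that
    by (meson order.trans one_le_numeral)
  then show "\<forall>k\<ge>2. \<exists>h0 h1. leading_powers h0 k k \<and> leading_powers h1 (2 * k - 1) k \<and>
      approx_form (gamma_bound k) h0 (k - 1) h1"
    by blast
  show "\<exists>h0 h1. leading_powers h0 2 2 \<and> leading_powers h1 3 2 \<and> approx_form (gamma_bound 2) h0 1 h1"
    using general[of 2] by simp
  show "\<exists>h0 h1. leading_powers h0 4 4 \<and> leading_powers h1 7 4 \<and> approx_form (gamma_bound 4) h0 3 h1"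
    using general[of 4] by simp
  show "\<exists>h0 h1. leading_powers h0 3 3 \<and> leading_powers h1 3 3 \<and>
      approx_form (gamma_bound 3) h0 2 (smult (monom 1 2) h1)"
    \<comment> \<open>Here \<open>s\<^sup>2\<close> is split off from the monomial with \<open>s\<^sup>5 a\<^sup>3\<close> that belongs to \<open>k = 3\<close>.\<close>
  proof (intro exI conjI)
    show "leading_powers (monom (monom (?c 3 0) 3) 3) 3 3"
      "leading_powers (monom (monom (?c 3 2) 3) 3) 3 3"
      using c[of 3] d[of 3] by (simp_all add: leading_powers_monom)
    have "smult (monom 1 2) (monom (monom (?c 3 2) 3) 3) = monom (monom (?c 3 2) 5) 3"
      by (simp add: smult_monom mult_monom)
    then show "approx_form (gamma_bound 3) (monom (monom (?c 3 0) 3) 3) 2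
        (smult (monom 1 2) (monom (monom (?c 3 2) 3) 3))"
      using approx_form_gamma_bound[of 3] by simp
  qed
  show "\<forall>k\<ge>1. \<exists>c::real. c \<noteq> 0 \<and>
      (\<forall>s a. s > 0 \<longrightarrow> a > 0 \<longrightarrow> gamma_bound k s a 0 = poly (monom c k) (a * s))"
  proof (intro allI impI)
    fix k :: nat
    assume "k \<ge> 1"
    then have "gamma_bound k s a 0 = poly (monom (?c k 0) k) (a * s)" for s a
      by (simp add: gamma_bound_eq poly_monom poly_0_coeff_0)
    then show "\<exists>c::real. c \<noteq> 0 \<and>
        (\<forall>s a. s > 0 \<longrightarrow> a > 0 \<longrightarrow> gamma_bound k s a 0 = poly (monom c k) (a * s))"
      using c[of k] by blast
  qed
qed

end
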